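(* If $X$ is a finite dimensional normed vector space, then $\mathcal A(X,c_0)=(0,1]$.
   Context: $c_0$ denotes the space of all real sequences converging to $0$, equipped with the supremum norm. For metric spaces $(X,d)$, $(Y,\varrho)$, $\alpha\in(0,1]$ and $K>0$, a map $f:X\to Y$ is called $(K,\alpha)$-Hölder if $\varrho(f(x),f(y))\le K d(x,y)^\alpha$ for all $x,y\in X$. $\mathcal A(X,Y)$ denotes the set of all $\alpha\in(0,1]$ such that for every $K>0$ and every subset $M\subset X$, any $(K,\alpha)$-Hölder function $f:M\to Y$ can be extended to a $(K,\alpha)$-Hölder function from $X$ into $Y$ (same constant $K$). Normed spaces are viewed as metric spaces with the norm distance. *)

theory Defs
  imports "HOL-Analysis.Analysis"
begin

definition hoelder_map ::
  "real \<Rightarrow> real \<Rightarrow> 'a::metric_space set \<Rightarrow> 'b::metric_space set \<Rightarrow> ('a \<Rightarrow> 'b) \<Rightarrow> bool"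
  where "hoelder_map K \<alpha> X Y f \<longleftrightarrow>
    f \<in> X \<rightarrow> Y \<and> (\<forall>x\<in>X. \<forall>y\<in>X. dist (f x) (f y) \<le> K * dist x y powr \<alpha>)"

definition hoelder_extension_exponents ::
  "'a::metric_space set \<Rightarrow> 'b::metric_space set \<Rightarrow> real set"
  where "hoelder_extension_exponents X Y =
    {\<alpha> \<in> {0<..1}. \<forall>K>0. \<forall>M\<subseteq>X. \<forall>f. hoelder_map K \<alpha> M Y f \<longrightarrow>
       (\<exists>g. hoelder_map K \<alpha> X Y g \<and> (\<forall>x\<in>M. g x = f x))}"

text \<open>
  Since \<open>nat\<close> carries the discrete topology, \<open>nat \<Rightarrow>\<^sub>C real\<close> is the space of all bounded
  real sequences with the supremum norm; the null sequences form a subset of it, with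
  the induced metric.
\<close>

definition c0 :: "(nat \<Rightarrow>\<^sub>C real) set"
  where "c0 = {x. apply_bcontfun x \<longlonglongrightarrow> 0}"

text \<open>No null sequence is lost by this encoding:\<close>

lemma apply_bcontfun_image_c0: "apply_bcontfun ` c0 = {x. x \<longlonglongrightarrow> 0}"
proof (intro equalityI subsetI)
  fix x :: "nat \<Rightarrow> real"
  assume "x \<in> {x. x \<longlonglongrightarrow> 0}"
  then have lim: "x \<longlonglongrightarrow> 0" by simp
  then have "bounded (range x)"
    by (intro convergent_imp_bounded)
  then have "x \<in> bcontfun"
    by (simp add: bcontfun_def)
  then have "apply_bcontfun (Bcontfun x) = x"
    by (rule Bcontfun_inverse)
  with lim show "x \<in> apply_bcontfun ` c0"
    by (metis (mono_tags, lifting) c0_def image_eqI mem_Collect_eq)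
qed (auto simp: c0_def)

end

theory Submission imports Defs begin

text \<open>
  Coordinatewise, a real Hoelder function on \<open>M\<close> has a least and a greatest
  extension (McShane), and clamping \<open>0\<close> between them is again an extension. The
  clamped coordinates form a null sequence at \<open>x\<close> as soon as, for every \<open>\<epsilon> > 0\<close>, a finite
  \<open>F \<subseteq> M\<close> controls the McShane suprema: every \<open>m \<in> M\<close> needs a \<open>p \<in> F\<close> with
  \<open>dist m p \<le> dist m x\<close> or \<open>dist m p \<le> \<epsilon>\<close>. For bounded \<open>M\<close> this is total boundedness. Far
  away it follows from compactness of the sphere: if \<open>m\<close> and \<open>p\<close> have
  nearly the same direction and \<open>2 * norm x \<le> norm p \<le> norm m\<close>, then
  \<open>norm (m - p) \<le> norm m - norm p / 2 \<le> norm (m - x)\<close>.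
\<close>

section \<open>Compactness in finite-dimensional normed spaces\<close>

text \<open>If \<open>b\<close> has distance at least \<delta> > 0 from \<open>span B\<close>, then
  a bound on \<open>t *\<^sub>R b + s\<close> bounds both \<open>t\<close> and \<open>s\<close>. So
  the ball in the larger span is a closed part of a continuous image of a compact product. The
  radius stays arbitrary because the induction hypothesis is used at two different radii.\<close>

lemma compact_span_Int_cball:
  fixes B :: "'a::real_normed_vector set"
  assumes "finite B"
  shows "compact (span B \<inter> cball 0 r)"
  using assms
proof (induction B arbitrary: r rule: finite_induct)
  case empty
  then show ?case
    by (simp add: finite_imp_compact)
next
  case (insert b B)
  show ?case
  proof (cases "b \<in> span B")
    case True
    then show ?thesis
      using insert.IH by (simp add: span_redundant)
  next
    case False
    then have b: "norm b > 0"
      using span_zero by fastforce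
    obtain \<delta> where \<delta>: "\<delta> > 0" "\<And>s. s \<in> span B \<Longrightarrow> \<delta> \<le> norm (b + s)"
    proof -
      \<comment> \<open>Beyond the radius \<open>2 * norm b\<close>, \<open>norm (b + s)\<close>
        exceeds \<open>norm b\<close>, so only this compact part matters for the infimum.\<close>
      let ?S = "span B \<inter> cball 0 (2 * norm b)"
      have "?S \<noteq> {}"
        using span_zero by (metis IntI centre_in_cball empty_iff mult_nonneg_nonneg norm_ge_zero zero_le_numeral)
      moreover have "continuous_on ?S (\<lambda>s. norm (b + s))"
        by (intro continuous_intros)
      ultimately obtain s0 where s0: "s0 \<in> ?S" "\<And>s. s \<in> ?S \<Longrightarrow> norm (b + s0) \<le> norm (b + s)"
        using continuous_attains_inf[OF insert.IH] by metis
      have "b + s0 \<noteq> 0"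
        using s0(1) False by (metis IntE add_eq_0_iff2 span_neg)
      then have "min (norm b) (norm (b + s0)) > 0"
        using b by simp
      moreover have "min (norm b) (norm (b + s0)) \<le> norm (b + s)" if "s \<in> span B" for s
      proof (cases "norm s \<le> 2 * norm b")
        case True
        then show ?thesis
          using s0(2) that by (simp add: min.coboundedI2)
      next
        case False
        moreover have "norm s - norm b \<le> norm (b + s)"
          by (metis add.commute norm_diff_ineq)
        ultimately show ?thesis
          by linarith
      qed
      ultimately show ?thesis
        using that by blast
    qed
    \<comment> \<open>The radii come from
      \<open>\<bar>t\<bar> * \<delta> \<le> norm x \<le> r\<close> and from the triangle inequality
      for \<open>s = x - t *\<^sub>R b\<close>.\<close>
    define C where "C = cball (0::real) (r / \<delta>) \<times> (span B \<inter> cball 0 (r + r / \<delta> * norm b))"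
    let ?f = "\<lambda>(t, s). t *\<^sub>R b + s"
    have "span (insert b B) \<inter> cball 0 r = ?f ` C \<inter> cball 0 r"
    proof (intro equalityI subsetI)
      fix x assume x: "x \<in> span (insert b B) \<inter> cball 0 r"
      then obtain t where t: "x - t *\<^sub>R b \<in> span B"
        using span_breakdown_eq by blast
      define s where "s = x - t *\<^sub>R b"
      have "\<bar>t\<bar> * \<delta> \<le> norm x"
      proof (cases "t = 0")
        case False
        have "\<delta> \<le> norm (b + (1 / t) *\<^sub>R s)"
          using t s_def by (intro \<delta>(2)) (simp add: span_scale)
        then have "\<bar>t\<bar> * \<delta> \<le> norm (t *\<^sub>R (b + (1 / t) *\<^sub>R s))"
          by (simp add: mult_left_mono)
        then show ?thesis
          using False by (simp add: s_def scaleR_add_right)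
      qed simp
      then have tb: "\<bar>t\<bar> \<le> r / \<delta>"
        using x \<delta>(1) by (simp add: field_simps)
      then have "norm (t *\<^sub>R b) \<le> r / \<delta> * norm b"
        using mult_right_mono[OF tb norm_ge_zero[of b]] by simp
      then have "norm s \<le> r + r / \<delta> * norm b"
        using x norm_triangle_ineq4[of x "t *\<^sub>R b"] unfolding s_def by simp
      then have "(t, s) \<in> C"
        using tb t by (simp add: C_def s_def)
      moreover have "x = ?f (t, s)"
        by (simp add: s_def)
      ultimately show "x \<in> ?f ` C \<inter> cball 0 r"
        using x by blast
    next
      fix x assume "x \<in> ?f ` C \<inter> cball 0 r"
      then show "x \<in> span (insert b B) \<inter> cball 0 r"
        unfolding C_def
        by (auto intro!: span_add span_scale intro: span_base span_mono[THEN subsetD, OF subset_insertI])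
    qed
    moreover have "compact (?f ` C)"
      unfolding C_def case_prod_unfold
      by (intro compact_continuous_image compact_Times compact_cball insert.IH continuous_intros)
    ultimately show ?thesis
      by (simp add: compact_Int_closed)
  qed
qed

lemma finite_dimensional_imp_compact_cball:
  fixes B :: "'a::real_normed_vector set"
  assumes "finite_dimensional_vector_space ((*\<^sub>R) :: real \<Rightarrow> 'a \<Rightarrow> 'a) B"
  shows "compact (cball (0::'a) r)"
proof -
  interpret F: finite_dimensional_vector_space "(*\<^sub>R) :: real \<Rightarrow> 'a \<Rightarrow> 'a" B
    by fact
  have "span B = UNIV"
    using F.span_Basis by (simp add: span_raw_def)
  then show ?thesis
    using compact_span_Int_cball[OF F.finite_Basis, of r] by simp
qed

text \<open>Balls centred in \<open>S\<close> already cover the compact closure of \<open>S\<close>,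
  so the net can be chosen inside \<open>S\<close>.\<close>

lemma bounded_finite_net:
  fixes S :: "'a::real_normed_vector set"
  assumes compact: "\<And>r. compact (cball (0::'a) r)" and "bounded S" "\<epsilon> > 0"
  obtains F where "finite F" "F \<subseteq> S" "\<And>x. x \<in> S \<Longrightarrow> \<exists>p\<in>F. dist x p \<le> \<epsilon>"
proof -
  obtain r where "S \<subseteq> cball 0 r"
    using \<open>bounded S\<close> unfolding bounded_iff by (meson mem_cball_0 subsetI)
  then have "closure S \<subseteq> cball 0 r"
    by (simp add: closure_minimal)
  then have "compact (closure S)"
    using compact_Int_closed[OF compact[of r] closed_closure[of S]] by (simp add: Int_absorb1)
  moreover have "closure S \<subseteq> (\<Union>p\<in>S. ball p \<epsilon>)"
    using \<open>\<epsilon> > 0\<close> by (auto simp: closure_approachable)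
  ultimately obtain F where "F \<subseteq> S" "finite F" "closure S \<subseteq> (\<Union>p\<in>F. ball p \<epsilon>)"
    by (metis compactE_image open_ball)
  then show ?thesis
    using that[of F] closure_subset[of S] by (force simp: dist_commute less_imp_le)
qed

lemma finite_control_set:
  fixes M :: "'a::real_normed_vector set"
  assumes compact: "\<And>r. compact (cball (0::'a) r)" and "\<epsilon> > 0"
  obtains F where "finite F" "F \<subseteq> M"
    "\<And>m. m \<in> M \<Longrightarrow> \<exists>p\<in>F. dist m p \<le> dist m x \<or> dist m p \<le> \<epsilon>"
proof -
  \<comment> \<open>\<open>A\<close> is the far part of \<open>M\<close>; the factor 2 will give
    \<open>norm x \<le> norm p / 2\<close> for \<open>p\<close> in \<open>A\<close>. If
    \<open>x = 0\<close>, then \<open>A\<close> may contain 0, which is harmless since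
    \<open>sgn 0 = 0\<close>.\<close>
  define A where "A = {m \<in> M. 2 * norm x \<le> norm m}"
  have "bounded (sgn ` A)"
    by (rule boundedI[of _ 1]) (auto simp: norm_sgn)
  then obtain G where "finite G" "G \<subseteq> sgn ` A"
    and G: "\<And>u. u \<in> sgn ` A \<Longrightarrow> \<exists>v\<in>G. dist u v \<le> 1 / 2"
    using bounded_finite_net[OF compact, of "sgn ` A" "1 / 2"] by (metis half_gt_zero zero_less_one)
  then obtain F0 where F0: "finite F0" "F0 \<subseteq> A" "G = sgn ` F0"
    using finite_subset_image by metis
  obtain R where R: "\<And>p. p \<in> F0 \<Longrightarrow> norm p \<le> R"
    using finite_imp_bounded[OF F0(1)] by (auto simp: bounded_iff)
  \<comment> \<open>With \<open>R\<close> in the cutoff, every \<open>m\<close> of \<open>M\<close>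
    outside \<open>S\<close> is farther out than all points of \<open>F0\<close>, and it also lies
    in \<open>A\<close>.\<close>
  define S where "S = {m \<in> M. norm m \<le> max R (2 * norm x)}"
  have "bounded S"
    unfolding S_def by (rule boundedI) auto
  then obtain F1 where F1: "finite F1" "F1 \<subseteq> S" "\<And>m. m \<in> S \<Longrightarrow> \<exists>p\<in>F1. dist m p \<le> \<epsilon>"
    using bounded_finite_net[OF compact] \<open>\<epsilon> > 0\<close> by metis
  have "\<exists>p\<in>F0. dist m p \<le> dist m x" if "m \<in> M" "m \<notin> S" for m
  proof -
    have m: "R < norm m" "2 * norm x < norm m"
      using that by (auto simp: S_def)
    then have "m \<in> A"
      using that by (simp add: A_def)
    then obtain p where p: "p \<in> F0" "norm (sgn m - sgn p) \<le> 1 / 2"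
      using G F0(3) by (force simp: dist_norm)
    have le: "norm p \<le> norm m" "2 * norm x \<le> norm p"
      using R[OF p(1)] m F0(2) p(1) by (auto simp: A_def)
    have polar: "norm z *\<^sub>R sgn z = z" for z :: 'a
      by (cases "z = 0") (simp_all add: sgn_div_norm)
    \<comment> \<open>A radial move in the direction of \<open>m\<close> costs
      \<open>norm m - norm p\<close>; the change of direction at radius \<open>norm p\<close> costs
      at most \<open>norm p / 2\<close>.\<close>
    have "m - p = (norm m - norm p) *\<^sub>R sgn m + norm p *\<^sub>R (sgn m - sgn p)"
      by (simp add: algebra_simps polar)
    then have "norm (m - p) \<le> norm ((norm m - norm p) *\<^sub>R sgn m) + norm (norm p *\<^sub>R (sgn m - sgn p))"
      by (metis norm_triangle_ineq)
    also have "\<dots> \<le> (norm m - norm p) * 1 + norm p * (1 / 2)"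
      unfolding norm_scaleR using le p(2) by (intro add_mono mult_mono) (auto simp: norm_sgn)
    also have "\<dots> \<le> norm m - norm x"
      using le by simp
    also have "\<dots> \<le> norm (m - x)"
      by (rule norm_triangle_ineq2)
    finally show ?thesis
      using p(1) by (auto simp: dist_norm)
  qed
  then show ?thesis
    using that[of "F0 \<union> F1"] F0(1,2) F1 unfolding A_def S_def by blast
qed

section \<open>McShane extensions\<close>

text \<open>By homogeneity one may divide by \<open>a + b\<close>; the two fractions add up to 1,
  and each is at most its own power with exponent \<alpha>.\<close>

lemma powr_subadditive:
  fixes a b :: real
  assumes "0 \<le> a" "0 \<le> b" "0 < \<alpha>" "\<alpha> \<le> 1"
  shows "(a + b) powr \<alpha> \<le> a powr \<alpha> + b powr \<alpha>"
proof (cases "a + b = 0")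
  case False
  have le: "t \<le> t powr \<alpha>" if "0 \<le> t" "t \<le> 1" for t :: real
    using that assms powr_mono'[of \<alpha> 1 t] by simp
  have "1 = a / (a + b) + b / (a + b)"
    using False by (simp add: add_divide_distrib[symmetric])
  also have "\<dots> \<le> (a / (a + b)) powr \<alpha> + (b / (a + b)) powr \<alpha>"
    using assms False by (intro add_mono le) auto
  also have "\<dots> = (a powr \<alpha> + b powr \<alpha>) / (a + b) powr \<alpha>"
    using assms by (simp add: powr_divide add_divide_distrib)
  finally show ?thesis
    using False assms by (simp add: field_simps)
qed (use assms in simp)

text \<open>Turns Hoelder maps into Lipschitz maps for the metric
  \<open>dist x y powr \<alpha>\<close>.\<close>

lemma dist_powr_triangle:
  fixes x y z :: "'a::metric_space"
  assumes "0 < \<alpha>" "\<alpha> \<le> 1"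
  shows "dist x z powr \<alpha> \<le> dist x y powr \<alpha> + dist y z powr \<alpha>"
proof -
  have "dist x z powr \<alpha> \<le> (dist x y + dist y z) powr \<alpha>"
    using assms by (intro powr_mono2 dist_triangle) auto
  also have "\<dots> \<le> dist x y powr \<alpha> + dist y z powr \<alpha>"
    using assms by (intro powr_subadditive) auto
  finally show ?thesis .
qed

text \<open>McShane's least extension. The greatest one is the negative of this formula applied to
  \<open>-f\<close>.\<close>

definition lower_extension ::
  "real \<Rightarrow> real \<Rightarrow> 'a::metric_space set \<Rightarrow> ('a \<Rightarrow> real) \<Rightarrow> 'a \<Rightarrow> real"
  where "lower_extension K \<alpha> M f x = (SUP m\<in>M. f m - K * dist x m powr \<alpha>)"

context
  fixes K \<alpha> :: real and M :: "'a::metric_space set" and f :: "'a \<Rightarrow> real"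
  assumes K: "K > 0" and \<alpha>: "0 < \<alpha>" "\<alpha> \<le> 1" and nonempty: "M \<noteq> {}"
    and hoelder: "\<And>x y. x \<in> M \<Longrightarrow> y \<in> M \<Longrightarrow> \<bar>f x - f y\<bar> \<le> K * dist x y powr \<alpha>"
begin

lemma scaled_triangle: "K * dist x z powr \<alpha> \<le> K * dist x y powr \<alpha> + K * dist y z powr \<alpha>"
  for x y z :: 'a
  using dist_powr_triangle[OF \<alpha>, of x z y] K by (simp flip: distrib_left)

text \<open>The bound is independent of \<open>m\<close>, so the supremum is over a bounded set;
  \<open>p = x\<close> makes the bound \<open>f x\<close>.\<close>

lemma lower_extension_term_le:
  assumes "m \<in> M" "p \<in> M"
  shows "f m - K * dist x m powr \<alpha> \<le> f p + K * dist x p powr \<alpha>"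
  using hoelder[OF assms] scaled_triangle[of m p x] by (simp add: dist_commute abs_le_iff)

lemma lower_extension_ge:
  assumes "m \<in> M"
  shows "f m - K * dist x m powr \<alpha> \<le> lower_extension K \<alpha> M f x"
  unfolding lower_extension_def
  using assms lower_extension_term_le by (intro cSUP_upper bdd_aboveI2) auto

lemma lower_extension_le:
  assumes "\<And>m. m \<in> M \<Longrightarrow> f m - K * dist x m powr \<alpha> \<le> c"
  shows "lower_extension K \<alpha> M f x \<le> c"
  unfolding lower_extension_def using nonempty assms by (rule cSUP_least)

lemma lower_extension_eq:
  assumes "x \<in> M"
  shows "lower_extension K \<alpha> M f x = f x"
  using lower_extension_ge[OF assms, of x] lower_extension_le[of x "f x"]
    lower_extension_term_le[of _ x x] assms by (simp add: antisym)

lemma lower_extension_diff_le: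
  "lower_extension K \<alpha> M f x \<le> lower_extension K \<alpha> M f y + K * dist x y powr \<alpha>"
proof (rule lower_extension_le)
  fix m assume "m \<in> M"
  then show "f m - K * dist x m powr \<alpha> \<le> lower_extension K \<alpha> M f y + K * dist x y powr \<alpha>"
    using lower_extension_ge[of m y] scaled_triangle[of y m x] by (simp add: dist_commute)
qed

lemma lower_extension_hoelder:
  "\<bar>lower_extension K \<alpha> M f x - lower_extension K \<alpha> M f y\<bar> \<le> K * dist x y powr \<alpha>"
  using lower_extension_diff_le[of x y] lower_extension_diff_le[of y x] by (simp add: dist_commute abs_le_iff)

text \<open>Replacing \<open>m\<close> by \<open>p\<close> changes \<open>f\<close> by at most
  \<open>K * dist m p powr \<alpha>\<close>. This is absorbed by the penalty
  \<open>K * dist x m powr \<alpha>\<close> or costs at most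
  \<open>K * \<epsilon> powr \<alpha>\<close>.\<close>

lemma lower_extension_le_finite:
  assumes F: "F \<subseteq> M" "\<And>m. m \<in> M \<Longrightarrow> \<exists>p\<in>F. dist m p \<le> dist m x \<or> dist m p \<le> \<epsilon>"
    and c: "\<And>p. p \<in> F \<Longrightarrow> f p \<le> c" and "0 \<le> \<epsilon>"
  shows "lower_extension K \<alpha> M f x \<le> c + K * \<epsilon> powr \<alpha>"
proof (rule lower_extension_le)
  fix m assume "m \<in> M"
  then obtain p where p: "p \<in> F" "dist m p \<le> dist m x \<or> dist m p \<le> \<epsilon>"
    using F(2) by blast
  have mono: "K * s powr \<alpha> \<le> K * t powr \<alpha>" if "0 \<le> s" "s \<le> t" for s t
    using that K \<alpha> by (simp add: powr_mono2)
  have "K * dist m p powr \<alpha> \<le> K * dist m x powr \<alpha> + K * \<epsilon> powr \<alpha>"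
    using p(2)
  proof
    assume "dist m p \<le> dist m x"
    then show ?thesis
      using mono[of "dist m p" "dist m x"] K by (simp add: add_increasing2)
  next
    assume "dist m p \<le> \<epsilon>"
    then show ?thesis
      using mono[of "dist m p" \<epsilon>] K by (simp add: add_increasing)
  qed
  moreover have "f m - f p \<le> K * dist m p powr \<alpha>"
    using hoelder[OF \<open>m \<in> M\<close>, of p] F(1) p(1) by auto
  ultimately show "f m - K * dist x m powr \<alpha> \<le> c + K * \<epsilon> powr \<alpha>"
    using c[OF p(1)] by (simp add: dist_commute)
qed

end

text \<open>The control set \<open>F\<close> does not depend on \<open>n\<close>, so pointwise
  convergence at its finitely many points suffices.\<close>

lemma lower_extension_eventually_less:
  fixes M :: "'a::real_normed_vector set" and f :: "nat \<Rightarrow> 'a \<Rightarrow> real"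
  assumes compact: "\<And>r. compact (cball (0::'a) r)"
    and K: "K > 0" and \<alpha>: "0 < \<alpha>" "\<alpha> \<le> 1" and nonempty: "M \<noteq> {}"
    and hoelder: "\<And>n x y. x \<in> M \<Longrightarrow> y \<in> M \<Longrightarrow> \<bar>f n x - f n y\<bar> \<le> K * dist x y powr \<alpha>"
    and lim: "\<And>m. m \<in> M \<Longrightarrow> (\<lambda>n. f n m) \<longlonglongrightarrow> 0"
    and "\<delta> > 0"
  shows "\<forall>\<^sub>F n in sequentially. lower_extension K \<alpha> M (f n) x < \<delta>"
proof -
  \<comment> \<open>Solves \<open>K * \<epsilon> powr \<alpha> = \<delta> / 3\<close>; with another
    third from \<open>F\<close>, the final bound is strict.\<close>
  define \<epsilon> where "\<epsilon> = (\<delta> / (3 * K)) powr (1 / \<alpha>)"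
  have \<epsilon>: "\<epsilon> > 0" "K * \<epsilon> powr \<alpha> = \<delta> / 3"
    using K \<alpha> \<open>\<delta> > 0\<close> by (simp_all add: \<epsilon>_def powr_powr)
  obtain F where F: "finite F" "F \<subseteq> M"
    "\<And>m. m \<in> M \<Longrightarrow> \<exists>p\<in>F. dist m p \<le> dist m x \<or> dist m p \<le> \<epsilon>"
    using finite_control_set[OF compact \<epsilon>(1), of M x] by metis
  have "\<forall>\<^sub>F n in sequentially. \<forall>p\<in>F. f n p < \<delta> / 3"
  proof (intro eventually_ball_finite F(1) ballI)
    fix p assume "p \<in> F"
    then show "\<forall>\<^sub>F n in sequentially. f n p < \<delta> / 3"
      using lim[of p] F(2) \<open>\<delta> > 0\<close> by (intro order_tendstoD(2)) auto
  qed
  then show ?thesis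
  proof eventually_elim
    case (elim n)
    have "lower_extension K \<alpha> M (f n) x \<le> \<delta> / 3 + K * \<epsilon> powr \<alpha>"
      using lower_extension_le_finite[OF K \<alpha> nonempty hoelder F(2,3)] elim \<epsilon>(1)
      by (meson less_imp_le)
    then show ?case
      using \<epsilon>(2) \<open>\<delta> > 0\<close> by simp
  qed
qed

text \<open>Neither McShane extension alone need tend to 0: for \<open>M = {0}\<close> and
  \<open>f = 0\<close> the lower one is \<open>- K * dist x 0 powr \<alpha>\<close> in every
  coordinate.\<close>

definition clamped_extension ::
  "real \<Rightarrow> real \<Rightarrow> 'a::metric_space set \<Rightarrow> ('a \<Rightarrow> real) \<Rightarrow> 'a \<Rightarrow> real"
  where "clamped_extension K \<alpha> M f x =
    max (lower_extension K \<alpha> M f x) (min 0 (- lower_extension K \<alpha> M (\<lambda>m. - f m) x))"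

lemma clamped_extension_eq:
  fixes f :: "'a::metric_space \<Rightarrow> real"
  assumes "K > 0" "0 < \<alpha>" "\<alpha> \<le> 1"
    and "\<And>x y. x \<in> M \<Longrightarrow> y \<in> M \<Longrightarrow> \<bar>f x - f y\<bar> \<le> K * dist x y powr \<alpha>"
    and "x \<in> M"
  shows "clamped_extension K \<alpha> M f x = f x"
proof -
  have ne: "M \<noteq> {}"
    using assms by blast
  have "\<bar>- f x - - f y\<bar> \<le> K * dist x y powr \<alpha>" if "x \<in> M" "y \<in> M" for x y
    using assms(4)[OF that] by simp
  then have "lower_extension K \<alpha> M (\<lambda>m. - f m) x = - f x"
    by (rule lower_extension_eq[OF assms(1-3) ne]) (use assms in auto)
  moreover have "lower_extension K \<alpha> M f x = f x"
    by (rule lower_extension_eq[OF assms(1-3) ne assms(4,5)])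
  ultimately show ?thesis
    by (simp add: clamped_extension_def)
qed

lemma clamped_extension_hoelder:
  fixes f :: "'a::metric_space \<Rightarrow> real"
  assumes "K > 0" "0 < \<alpha>" "\<alpha> \<le> 1" "M \<noteq> {}"
    and "\<And>x y. x \<in> M \<Longrightarrow> y \<in> M \<Longrightarrow> \<bar>f x - f y\<bar> \<le> K * dist x y powr \<alpha>"
  shows "\<bar>clamped_extension K \<alpha> M f x - clamped_extension K \<alpha> M f y\<bar> \<le> K * dist x y powr \<alpha>"
proof -
  have "\<bar>- f x - - f y\<bar> \<le> K * dist x y powr \<alpha>" if "x \<in> M" "y \<in> M" for x y
    using assms(5)[OF that] by simp
  note 1 = lower_extension_hoelder[OF assms(1-4) this, of x y]
  note 2 = lower_extension_hoelder[OF assms, of x y]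
  \<comment> \<open>\<open>max\<close> and \<open>min\<close> preserve a common modulus of
    continuity.\<close>
  show ?thesis
    using 1 2 unfolding clamped_extension_def by linarith
qed

text \<open>Eventually the least extension is below \<delta> and the greatest is above -\<delta>;
  clamping 0 between them then gives a value in between.\<close>

lemma clamped_extension_tendsto_0:
  fixes M :: "'a::real_normed_vector set" and f :: "nat \<Rightarrow> 'a \<Rightarrow> real"
  assumes compact: "\<And>r. compact (cball (0::'a) r)"
    and "K > 0" "0 < \<alpha>" "\<alpha> \<le> 1" "M \<noteq> {}"
    and hoelder: "\<And>n x y. x \<in> M \<Longrightarrow> y \<in> M \<Longrightarrow> \<bar>f n x - f n y\<bar> \<le> K * dist x y powr \<alpha>"
    and lim: "\<And>m. m \<in> M \<Longrightarrow> (\<lambda>n. f n m) \<longlonglongrightarrow> 0"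
  shows "(\<lambda>n. clamped_extension K \<alpha> M (f n) x) \<longlonglongrightarrow> 0"
proof (rule tendstoI)
  fix \<delta> :: real assume "\<delta> > 0"
  have "\<bar>- f n x - - f n y\<bar> \<le> K * dist x y powr \<alpha>" if "x \<in> M" "y \<in> M" for n x y
    using hoelder[OF that, of n] by simp
  moreover have "(\<lambda>n. - f n m) \<longlonglongrightarrow> 0" if "m \<in> M" for m
    using tendsto_minus[OF lim[OF that]] by simp
  ultimately have "\<forall>\<^sub>F n in sequentially. lower_extension K \<alpha> M (\<lambda>m. - f n m) x < \<delta>"
    by (rule lower_extension_eventually_less[OF assms(1-5) _ _ \<open>\<delta> > 0\<close>])
  moreover have "\<forall>\<^sub>F n in sequentially. lower_extension K \<alpha> M (f n) x < \<delta>"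
    by (rule lower_extension_eventually_less[OF assms \<open>\<delta> > 0\<close>])
  ultimately show "\<forall>\<^sub>F n in sequentially. dist (clamped_extension K \<alpha> M (f n) x) 0 < \<delta>"
  proof eventually_elim
    case (elim n)
    then show ?case
      using \<open>\<delta> > 0\<close> unfolding clamped_extension_def dist_real_def by linarith
  qed
qed

section \<open>Extension of maps into the space of null sequences\<close>

text \<open>In the supremum norm a map is Hoelder exactly when its coordinates are so with the same
  \<open>K\<close>, so the coordinates can be extended separately.\<close>

lemma hoelder_extension_c0:
  fixes M :: "'a::real_normed_vector set"
  assumes compact: "\<And>r. compact (cball (0::'a) r)"
    and K: "K > 0" and \<alpha>: "0 < \<alpha>" "\<alpha> \<le> 1" and f: "hoelder_map K \<alpha> M c0 f"
  obtains g where "hoelder_map K \<alpha> UNIV c0 g" "\<And>x. x \<in> M \<Longrightarrow> g x = f x"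
proof (cases "M = {}")
  case True
  \<comment> \<open>The McShane suprema need a nonempty \<open>M\<close>; here any Hoelder map will
    do.\<close>
  have "hoelder_map K \<alpha> (UNIV :: 'a set) c0 (\<lambda>_. 0)"
    using K by (simp add: hoelder_map_def c0_def)
  then show ?thesis
    using that True by blast
next
  case False
  define h where "h n x = apply_bcontfun (f x) n" for n x
  have hoelder: "\<bar>h n x - h n y\<bar> \<le> K * dist x y powr \<alpha>" if "x \<in> M" "y \<in> M" for n x y
    using f that dist_bounded[of "f x" n "f y"] order_trans
    unfolding hoelder_map_def h_def dist_real_def by blast
  have lim: "(\<lambda>n. h n m) \<longlonglongrightarrow> 0" if "m \<in> M" for m
    using f that by (auto simp: hoelder_map_def c0_def h_def)
  note null = clamped_extension_tendsto_0[OF compact K \<alpha> False hoelder lim]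
  have "\<exists>z\<in>c0. apply_bcontfun z = (\<lambda>n. clamped_extension K \<alpha> M (h n) x)" for x
  proof -
    have "(\<lambda>n. clamped_extension K \<alpha> M (h n) x) \<in> apply_bcontfun ` c0"
      unfolding apply_bcontfun_image_c0 using null[of x] by simp
    then show ?thesis
      by force
  qed
  then obtain g where g: "\<And>x. g x \<in> c0"
    "\<And>x. apply_bcontfun (g x) = (\<lambda>n. clamped_extension K \<alpha> M (h n) x)"
    by metis
  show ?thesis
  proof
    have "dist (g x) (g y) \<le> K * dist x y powr \<alpha>" for x y
      using clamped_extension_hoelder[OF K \<alpha> False hoelder]
      by (intro dist_bound) (simp add: g dist_real_def)
    then show "hoelder_map K \<alpha> UNIV c0 g"
      using g(1) by (simp add: hoelder_map_def)
  next
    fix x assume "x \<in> M"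
    then have "apply_bcontfun (g x) n = apply_bcontfun (f x) n" for n
      using clamped_extension_eq[OF K \<alpha> hoelder \<open>x \<in> M\<close>] by (simp add: g(2)) (simp add: h_def)
    then show "g x = f x"
      by (intro bcontfun_eqI)
  qed
qed

theorem theorem2p3:
  assumes "\<exists>B. finite_dimensional_vector_space ((*\<^sub>R) :: real \<Rightarrow> 'a::real_normed_vector \<Rightarrow> 'a) B"
  shows "hoelder_extension_exponents (UNIV :: 'a set) c0 = {0<..1}"
proof -
  have "compact (cball (0::'a) r)" for r
    using assms finite_dimensional_imp_compact_cball by blast
  then show ?thesis
    unfolding hoelder_extension_exponents_def
    using hoelder_extension_c0 by (auto; metis)
qed

end
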